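(* Let $V_n\subset V_h$, $\Pi_n$, $\mathsf A_h$, $\mathsf B_h$, $\mathsf C_n$, $\nu>0$, $\Delta t>0$ be as in the context, and assume the verifiable regime described there. Assume that for all $v\in V_n$ $$\langle \Pi_n\mathsf B_h(v,v),v\rangle_h=0,\qquad \langle \mathsf C_n(v),v\rangle_h\ge 0 .$$ Let $\theta\in[\tfrac12,1]$ and write $u_n^{k+\theta}:=\theta u_n^{k+1}+(1-\theta)u_n^k$. Then any certified step $u_n^k\mapsto u_n^{k+1}$ (both in $V_n$), i.e. any solution of $$\frac{u_n^{k+1}-u_n^k}{\Delta t}+\nu\,\Pi_n\mathsf A_h u_n^{k+\theta}+\Pi_n\mathsf B_h(u_n^{k+\theta},u_n^{k+\theta})+\mathsf C_n(u_n^{k+\theta})=\Pi_n f_h^{k+\theta},$$ satisfies the discrete energy inequality $$\tfrac12\|u_n^{k+1}\|_h^2-\tfrac12\|u_n^k\|_h^2+\nu\,\Delta t\,\|\nabla u_n^{k+\theta}\|_h^2+\Delta t\,\langle \mathsf C_n(u_n^{k+\theta}),u_n^{k+\theta}\rangle_h\le \Delta t\,\langle f_h^{k+\theta},u_n^{k+\theta}\rangle .$$ Consequently, for any $\varepsilon>0$, $$\tfrac12\|u_n^{k+1}\|_h^2-\tfrac12\|u_n^k\|_h^2+(\nu-\varepsilon)\,\Delta t\,\|\nabla u_n^{k+\theta}\|_h^2\le \frac{\Delta t}{4\varepsilon}\,\|f_h^{k+\theta}\|_{V_h'}^2 .$$ In particular, if $\varepsilon\in(0,\nu)$ is fixed,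 $u_n^0,\dots,u_n^K$ are produced by certified steps, and $\sum_{j=0}^{K-1}\Delta t\,\|f_h^{j+\theta}\|_{V_h'}^2$ is finite, then $$\sup_{0\le k\le K}\|u_n^k\|_h^2+2(\nu-\varepsilon)\sum_{j=0}^{K-1}\Delta t\,\|\nabla u_n^{j+\theta}\|_h^2\le \|u_n^0\|_h^2+\frac1{2\varepsilon}\sum_{j=0}^{K-1}\Delta t\,\|f_h^{j+\theta}\|_{V_h'}^2 .$$
   Context: Verifiable regime: $T>0$; $\Omega\subset\mathbb R^d$ ($d\in\{2,3\}$) is a bounded Lipschitz domain with periodic or no-slip boundary conditions and known Poincaré constant $C_P$; $V=\{v\in H^1_0(\Omega)^d:\operatorname{div}v=0\}$ (or its periodic analogue), $H=\overline V^{L^2}$; the force $f\in L^2(0,T;V')$ and the initial datum $u_0\in H$ have known norms; convection is represented by a skew-symmetric form, both in the full-order discretization and in the reduced model; the spatial discretization has a discrete Poincaré inequality with known constant and the discrete skew-symmetry below (and, when pressure is present, an inf--sup stable pair). Full-order discretization: $H_h$ is the (finite-dimensional) discrete $L^2$ space for the velocity with inner product $\langle\cdot,\cdot\rangle_h$ and norm $\|\cdot\|_h$; $V_h\subset H_h$ is the discrete solenoidal space. $\mathsf A_h:V_h\to V_h$ is the discrete Stokes operator (symmetric positive semidefinite), and $\mathsf B_h:V_h\times V_h\to V_h$ is the discrete convection operator, with $\langle\mathsf B_h(w,v),v\rangle_h=0$ for all $w,v\in V_h$. $\|\nabla\cdot\|_h$ is the declared discrete gradient norm on $V_h$, and $\|g\|_{V_h'}=\sup_{0\ne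 v\in V_h}\langle g,v\rangle/\|\nabla v\|_h$ is the induced dual norm. Part of the definition of a certified step is viscous coercivity: $\langle\mathsf A_hv,v\rangle_h=\|\nabla v\|_h^2$. Reduced model: $V_n=\operatorname{span}\{\varphi_1,\dots,\varphi_n\}\subset V_h$ with linearly independent $\varphi_i$; $\Pi_n:V_h\to V_n$ is the $\langle\cdot,\cdot\rangle_h$-orthogonal projector; $\mathsf C_n:V_n\to V_n$ is a (possibly nonlinear) closure operator. $f_h^{k+\theta}$ is a given discrete forcing at time level $t^{k+\theta}$, with $t^k=k\Delta t$; it is identified with the functional $\langle f_h^{k+\theta},v\rangle=\langle f_h^{k+\theta},v\rangle_h$ on $V_h$.
   Formalization: The last display is false as printed (with f=0 the supremum is already attained at k=0); it is proved with the dissipation sum inside the supremum and running only to j=k-1, i.e. the supremum over k of the squared norm plus the dissipation up to step k. *)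

theory Defs
  imports "HOL-Analysis.Analysis"
begin

section \<open>The continuous problem\<close>

type_synonym 'd field = "real^'d \<Rightarrow> real^'d"
type_synonym 'd grad_field = "real^'d \<Rightarrow> real^'d^'d"

text \<open>Near every boundary point the domain lies strictly above a Lipschitz graph over the hyperplane
  orthogonal to some unit vector \<open>e\<close>.\<close>

definition lipschitz_domain :: "(real^'d) set \<Rightarrow> bool" where
  "lipschitz_domain \<Omega> \<longleftrightarrow> open \<Omega> \<and> connected \<Omega> \<and> \<Omega> \<noteq> {} \<and>
     (\<forall>x\<in>frontier \<Omega>. \<exists>r>0. \<exists>e \<gamma> L. norm e = 1 \<and> lipschitz_on L UNIV \<gamma> \<and>
        \<Omega> \<inter> ball x r = {y \<in> ball x r. \<gamma> (y - (y \<bullet> e) *\<^sub>R e) < y \<bullet> e})"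

text \<open>\<open>Periodic p\<close>: the domain is a box with side lengths \<open>p $ i\<close>, and fields are
  \<open>p $ i\<close>-periodic in the \<open>i\<close>-th coordinate.\<close>

datatype 'd boundary_condition = No_Slip | Periodic "real^'d"

fun bc_domain :: "('d::finite) boundary_condition \<Rightarrow> (real^'d) set \<Rightarrow> bool" where
  "bc_domain No_Slip \<Omega> \<longleftrightarrow> True"
| "bc_domain (Periodic p) \<Omega> \<longleftrightarrow> (\<forall>i. 0 < p $ i) \<and> (\<exists>a. \<Omega> = box a (a + p))"

primrec Ck :: "nat \<Rightarrow> ('a::euclidean_space \<Rightarrow> 'b::real_normed_vector) \<Rightarrow> bool" where
  "Ck 0 g \<longleftrightarrow> continuous_on UNIV g"
| "Ck (Suc k) g \<longleftrightarrow> (\<forall>x. g differentiable (at x)) \<and>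
     (\<forall>e\<in>Basis. Ck k (\<lambda>x. frechet_derivative g (at x) e))"

definition jacobian :: "('d::finite) field \<Rightarrow> 'd grad_field" where
  "jacobian g x = matrix (frechet_derivative g (at x))"

text \<open>In the periodic case the mean over the period cell is required to vanish, as usual, so that a
  Poincare inequality can hold.\<close>

fun test_field :: "('d::finite) boundary_condition \<Rightarrow> (real^'d) set \<Rightarrow> 'd field \<Rightarrow> bool" where
  "test_field No_Slip \<Omega> g \<longleftrightarrow> (\<forall>k. Ck k g) \<and>
     compact (closure {x. g x \<noteq> 0}) \<and> closure {x. g x \<noteq> 0} \<subseteq> \<Omega>"
| "test_field (Periodic p) \<Omega> g \<longleftrightarrow> (\<forall>k. Ck k g) \<and>
     (\<forall>x i. g (x + axis i (p $ i)) = g x) \<and> set_lebesgue_integral lebesgue \<Omega> g = 0"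

definition L2_on :: "(real^'d) set \<Rightarrow> (real^'d \<Rightarrow> 'b::euclidean_space) \<Rightarrow> bool" where
  "L2_on \<Omega> v \<longleftrightarrow> set_borel_measurable lebesgue \<Omega> v \<and>
     set_integrable lebesgue \<Omega> (\<lambda>x. (norm (v x))\<^sup>2)"

definition L2_norm :: "(real^'d) set \<Rightarrow> (real^'d \<Rightarrow> 'b::euclidean_space) \<Rightarrow> real" where
  "L2_norm \<Omega> v = sqrt (set_lebesgue_integral lebesgue \<Omega> (\<lambda>x. (norm (v x))\<^sup>2))"

text \<open>Sobolev fields are carried together with their weak gradient: the set below is the closure of
  the test fields in the \<open>H\<^sup>1\<close> norm, that is, \<open>H\<^sup>1\<^sub>0(\<Omega>)\<^sup>d\<close> or its
  periodic mean-zero analogue. Fields are not identified when they agree almost everywhere.\<close>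

definition sobolev_zero :: "('d::finite) boundary_condition \<Rightarrow> (real^'d) set \<Rightarrow> ('d field \<times> 'd grad_field) set" where
  "sobolev_zero bc \<Omega> = {(v, G). L2_on \<Omega> v \<and> L2_on \<Omega> G \<and>
     (\<forall>\<delta>>0. \<exists>g. test_field bc \<Omega> g \<and> L2_norm \<Omega> (\<lambda>x. v x - g x) < \<delta> \<and>
        L2_norm \<Omega> (\<lambda>x. G x - jacobian g x) < \<delta>)}"

definition V_space :: "('d::finite) boundary_condition \<Rightarrow> (real^'d) set \<Rightarrow> ('d field \<times> 'd grad_field) set" where
  "V_space bc \<Omega> = {(v, G) \<in> sobolev_zero bc \<Omega>. AE x in lebesgue. x \<in> \<Omega> \<longrightarrow> trace (G x) = 0}"

definition H_space :: "('d::finite) boundary_condition \<Rightarrow> (real^'d) set \<Rightarrow> 'd field set" where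
  "H_space bc \<Omega> = {u. L2_on \<Omega> u \<and>
     (\<forall>\<delta>>0. \<exists>(v, G) \<in> V_space bc \<Omega>. L2_norm \<Omega> (\<lambda>x. u x - v x) < \<delta>)}"

definition V_dual :: "('d::finite) boundary_condition \<Rightarrow> (real^'d) set \<Rightarrow> ('d field \<Rightarrow> real) set" where
  "V_dual bc \<Omega> = {l.
     (\<forall>(v, G) \<in> V_space bc \<Omega>. \<forall>(w, K) \<in> V_space bc \<Omega>. \<forall>a b.
        l (\<lambda>x. a *\<^sub>R v x + b *\<^sub>R w x) = a * l v + b * l w) \<and>
     (\<exists>M. \<forall>(v, G) \<in> V_space bc \<Omega>. \<bar>l v\<bar> \<le> M * L2_norm \<Omega> G)}"

definition V_dual_norm :: "('d::finite) boundary_condition \<Rightarrow> (real^'d) set \<Rightarrow> ('d field \<Rightarrow> real) \<Rightarrow> real" where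
  "V_dual_norm bc \<Omega> l = Sup {\<bar>l v\<bar> | v G. (v, G) \<in> V_space bc \<Omega> \<and> L2_norm \<Omega> G \<le> 1}"

text \<open>Since \<open>V\<close> is a separable Hilbert space, strong measurability into \<open>V'\<close> is the
  measurability of \<open>t \<mapsto> F t v\<close> for each \<open>v\<close> in \<open>V\<close>.\<close>

definition L2_V_dual :: "real \<Rightarrow> ('d::finite) boundary_condition \<Rightarrow> (real^'d) set \<Rightarrow> (real \<Rightarrow> 'd field \<Rightarrow> real) \<Rightarrow> bool" where
  "L2_V_dual T bc \<Omega> F \<longleftrightarrow>
     (\<forall>t\<in>{0<..<T}. F t \<in> V_dual bc \<Omega>) \<and>
     (\<forall>(v, G) \<in> V_space bc \<Omega>. set_borel_measurable lebesgue {0<..<T} (\<lambda>t. F t v)) \<and>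
     set_integrable lebesgue {0<..<T} (\<lambda>t. (V_dual_norm bc \<Omega> (F t))\<^sup>2)"

locale continuous_problem =
  fixes T :: real
    and \<Omega> :: "(real^'d::finite) set"
    and bc :: "'d boundary_condition"
    and C_P :: real
    and F :: "real \<Rightarrow> 'd field \<Rightarrow> real"
    and U0 :: "'d field"
  assumes time_pos: "0 < T"
    and dimension: "CARD('d) \<in> {2, 3}"
    and bounded_domain: "bounded \<Omega>"
    and domain: "lipschitz_domain \<Omega>"
    and boundary: "bc_domain bc \<Omega>"
    and poincare_pos: "0 < C_P"
    and poincare: "\<And>v G. (v, G) \<in> sobolev_zero bc \<Omega> \<Longrightarrow> L2_norm \<Omega> v \<le> C_P * L2_norm \<Omega> G"
    and force: "L2_V_dual T bc \<Omega> F"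
    and initial: "U0 \<in> H_space bc \<Omega>"

section \<open>The full-order discretization\<close>

text \<open>The discrete space \<open>H\<^sub>h\<close> is the whole type \<open>'h\<close>; its inner product
  and norm are the ones of the class \<^class>\<open>euclidean_space\<close>.\<close>

definition is_norm_on :: "'h::real_vector set \<Rightarrow> ('h \<Rightarrow> real) \<Rightarrow> bool" where
  "is_norm_on X N \<longleftrightarrow>
     (\<forall>v\<in>X. 0 \<le> N v \<and> (N v = 0 \<longleftrightarrow> v = 0)) \<and>
     (\<forall>v\<in>X. \<forall>a. N (a *\<^sub>R v) = \<bar>a\<bar> * N v) \<and>
     (\<forall>v\<in>X. \<forall>w\<in>X. N (v + w) \<le> N v + N w)"

text \<open>The dual norm of a functional \<open>g\<close>; the case distinction fixes the value on the zero space, where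
  the supremum is over the empty set.\<close>

definition dual_norm :: "'h::real_vector set \<Rightarrow> ('h \<Rightarrow> real) \<Rightarrow> ('h \<Rightarrow> real) \<Rightarrow> real" where
  "dual_norm X N g = (if X \<subseteq> {0} then 0 else (SUP v\<in>X - {0}. g v / N v))"

text \<open>In \<open>Mixed X Q b\<close>, \<open>X\<close> and \<open>Q\<close> are the velocity and pressure spaces and
  \<open>b\<close> is the discrete divergence form; the solenoidal space is then the kernel of \<open>b\<close>, and
  the gradient norm is defined on \<open>X\<close>.\<close>

datatype ('h, 'q) pressure_treatment =
  Pressure_Free | Mixed "'h set" "'q set" "'h \<Rightarrow> 'q \<Rightarrow> real"

fun stable_pressure ::
  "('h::euclidean_space, 'q::euclidean_space) pressure_treatment \<Rightarrow> 'h set \<Rightarrow> ('h \<Rightarrow> real) \<Rightarrow> bool" where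
  "stable_pressure Pressure_Free Vh N \<longleftrightarrow> True"
| "stable_pressure (Mixed X Q b) Vh N \<longleftrightarrow>
     subspace X \<and> subspace Q \<and> bilinear b \<and> is_norm_on X N \<and>
     Vh = {v\<in>X. \<forall>q\<in>Q. b v q = 0} \<and>
     (\<exists>\<beta>>0. \<forall>q\<in>Q. \<beta> * norm q \<le> dual_norm X N (\<lambda>v. b v q))"

text \<open>The gradient norm is \<open>gradn v\<close>, standing for \<open>\<parallel>\<nabla> v\<parallel>\<^sub>h\<close>.\<close>

locale full_order_discretization =
  fixes Vh :: "'h::euclidean_space set"
    and A :: "'h \<Rightarrow> 'h"
    and B :: "'h \<Rightarrow> 'h \<Rightarrow> 'h"
    and gradn :: "'h \<Rightarrow> real"
    and C_h :: real
    and pressure :: "('h, 'q::euclidean_space) pressure_treatment"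
  assumes Vh_subspace: "subspace Vh"
    and A_closed: "\<And>v. v \<in> Vh \<Longrightarrow> A v \<in> Vh"
    and A_linear: "\<And>v w a b. v \<in> Vh \<Longrightarrow> w \<in> Vh \<Longrightarrow> A (a *\<^sub>R v + b *\<^sub>R w) = a *\<^sub>R A v + b *\<^sub>R A w"
    and A_symmetric: "\<And>v w. v \<in> Vh \<Longrightarrow> w \<in> Vh \<Longrightarrow> A v \<bullet> w = v \<bullet> A w"
    and A_nonneg: "\<And>v. v \<in> Vh \<Longrightarrow> 0 \<le> A v \<bullet> v"
    and B_closed: "\<And>w v. w \<in> Vh \<Longrightarrow> v \<in> Vh \<Longrightarrow> B w v \<in> Vh"
    and B_skew: "\<And>w v. w \<in> Vh \<Longrightarrow> v \<in> Vh \<Longrightarrow> B w v \<bullet> v = 0"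
    and gradn_norm: "is_norm_on Vh gradn"
    and discrete_poincare_pos: "0 < C_h"
    and discrete_poincare: "\<And>v. v \<in> Vh \<Longrightarrow> norm v \<le> C_h * gradn v"
    and inf_sup: "stable_pressure pressure Vh gradn"

section \<open>The reduced model\<close>

definition orth_proj :: "'h::euclidean_space set \<Rightarrow> 'h \<Rightarrow> 'h" where
  "orth_proj W x = (THE y. y \<in> W \<and> (\<forall>w\<in>W. (x - y) \<bullet> w = 0))"

definition theta_avg :: "real \<Rightarrow> (nat \<Rightarrow> 'h::real_vector) \<Rightarrow> nat \<Rightarrow> 'h" where
  "theta_avg \<theta> u k = \<theta> *\<^sub>R u (Suc k) + (1 - \<theta>) *\<^sub>R u k"

text \<open>\<open>f k\<close> stands for the forcing at time level \<open>(k + \<theta>) \<Delta>t\<close>. Viscous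
  coercivity is part of the definition of a certified step.\<close>

definition certified_step ::
  "'h::euclidean_space set \<Rightarrow> 'h set \<Rightarrow> ('h \<Rightarrow> 'h) \<Rightarrow> ('h \<Rightarrow> 'h \<Rightarrow> 'h) \<Rightarrow> ('h \<Rightarrow> 'h) \<Rightarrow> ('h \<Rightarrow> real) \<Rightarrow>
   real \<Rightarrow> real \<Rightarrow> real \<Rightarrow> (nat \<Rightarrow> 'h) \<Rightarrow> (nat \<Rightarrow> 'h) \<Rightarrow> nat \<Rightarrow> bool" where
  "certified_step Vh Vn A B C gradn \<nu> \<Delta>t \<theta> f u k \<longleftrightarrow>
     (\<forall>v\<in>Vh. A v \<bullet> v = (gradn v)\<^sup>2) \<and>
     u k \<in> Vn \<and> u (Suc k) \<in> Vn \<and>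
     (1 / \<Delta>t) *\<^sub>R (u (Suc k) - u k) + \<nu> *\<^sub>R orth_proj Vn (A (theta_avg \<theta> u k))
       + orth_proj Vn (B (theta_avg \<theta> u k) (theta_avg \<theta> u k)) + C (theta_avg \<theta> u k)
     = orth_proj Vn (f k)"

end

theory Submission
  imports Defs
begin

text \<open>
  Write \<open>U\<close> for the theta average of a step. The estimate comes from testing the step equation with
  \<open>U\<close>, which lies in the reduced space \<open>Vn\<close>. Testing with an element of \<open>Vn\<close> makes the projector
  disappear (\<open>orth_proj_inner\<close>), so the viscous term gives the squared gradient norm by viscous
  coercivity, the convection term vanishes by skew-symmetry, and the closure and forcing terms appear as
  in the claim. The increment of the step, tested with \<open>U\<close>, is the increment of the kinetic energy
  plus \<open>(\<theta> - 1/2)\<close> times its own squared norm (\<open>theta_increment_identity\<close>); this surplus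
  is the numerical dissipation and is nonnegative for \<open>\<theta> \<ge> 1/2\<close>.

  For the second estimate the closure term is dropped, and the forcing is bounded by the product of its
  dual norm and the gradient norm of \<open>U\<close>, and then by Young's inequality. The bound by the dual norm
  (\<open>le_dual_norm_times\<close>) requires the supremum defining the dual norm to be taken over a set that is
  bounded above; the discrete Poincare inequality guarantees this. The last estimate follows by
  telescoping (\<open>telescoped_energy_bound\<close>).
\<close>

text \<open>The projector is a definite description. The point described exists by the orthogonal
  decomposition along \<open>W\<close>; it is unique because the difference of two such points lies in \<open>W\<close> and
  is orthogonal to \<open>W\<close>.\<close>

lemma orth_proj_inner:
  fixes W :: "'h::euclidean_space set"
  assumes "subspace W" "w \<in> W"
  shows "orth_proj W x \<bullet> w = x \<bullet> w"
proof -
  obtain y z where y: "y \<in> span W" and z: "\<And>w. w \<in> span W \<Longrightarrow> orthogonal z w"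
    and x: "x = y + z"
    using orthogonal_subspace_decomp_exists by blast
  have W: "span W = W"
    using \<open>subspace W\<close> by (simp add: span_eq_iff)
  have "orth_proj W x \<in> W \<and> (\<forall>w\<in>W. (x - orth_proj W x) \<bullet> w = 0)"
    unfolding orth_proj_def
  proof (rule theI)
    show "y \<in> W \<and> (\<forall>w\<in>W. (x - y) \<bullet> w = 0)"
      using x y z W by (auto simp: orthogonal_def)
  next
    fix y' assume y': "y' \<in> W \<and> (\<forall>w\<in>W. (x - y') \<bullet> w = 0)"
    have "y' - y \<in> W"
      using assms y y' W by (simp add: subspace_diff)
    then have "(x - y) \<bullet> (y' - y) = 0" "(x - y') \<bullet> (y' - y) = 0"
      using x y' z W by (auto simp: orthogonal_def)
    then have "(y' - y) \<bullet> (y' - y) = 0"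
      by (simp add: inner_diff_left)
    then show "y' = y"
      by simp
  qed
  with \<open>w \<in> W\<close> show ?thesis
    by (auto simp: inner_diff_left)
qed

lemma le_dual_norm_times:
  assumes N: "is_norm_on X N"
    and bdd: "bdd_above ((\<lambda>v. g v / N v) ` (X - {0}))"
    and g0: "g 0 = 0" and v: "v \<in> X"
  shows "g v \<le> dual_norm X N g * N v"
proof (cases "v = 0")
  case True
  then have "N v = 0"
    using N v by (auto simp: is_norm_on_def)
  with True g0 show ?thesis
    by simp
next
  case False
  then have "0 < N v"
    using N v by (auto simp: is_norm_on_def less_le)
  moreover have "g v / N v \<le> dual_norm X N g"
    unfolding dual_norm_def using v False by (auto intro: cSUP_upper[OF _ bdd])
  ultimately show ?thesis
    by (simp add: pos_divide_le_eq)
qed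

text \<open>A Poincare inequality bounds the quotients in the dual norm of \<open>v \<mapsto> g \<bullet> v\<close> by
  Cauchy-Schwarz, so that they are bounded above.\<close>

lemma inner_le_dual_norm_times:
  fixes X :: "'h::real_inner set"
  assumes N: "is_norm_on X N"
    and poincare: "\<And>v. v \<in> X \<Longrightarrow> norm v \<le> c * N v"
    and v: "v \<in> X"
  shows "g \<bullet> v \<le> dual_norm X N (\<lambda>w. g \<bullet> w) * N v"
proof (rule le_dual_norm_times[OF N _ _ v])
  have "g \<bullet> w / N w \<le> norm g * c" if w: "w \<in> X - {0}" for w
  proof -
    have "0 < N w"
      using N w by (auto simp: is_norm_on_def less_le)
    moreover have "g \<bullet> w \<le> norm g * c * N w"
    proof -
      have "g \<bullet> w \<le> norm g * norm w"
        by (rule norm_cauchy_schwarz)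
      also have "\<dots> \<le> norm g * (c * N w)"
        using poincare w by (intro mult_left_mono) auto
      finally show ?thesis
        by (simp add: mult.assoc)
    qed
    ultimately show ?thesis
      by (simp add: pos_divide_le_eq)
  qed
  then show "bdd_above ((\<lambda>w. g \<bullet> w / N w) ` (X - {0}))"
    by (rule bdd_aboveI2)
qed simp

lemma theta_increment_identity:
  fixes u :: "nat \<Rightarrow> 'h::real_inner"
  shows "(u (Suc k) - u k) \<bullet> theta_avg \<theta> u k
    = 1 / 2 * (norm (u (Suc k)))\<^sup>2 - 1 / 2 * (norm (u k))\<^sup>2
      + (\<theta> - 1 / 2) * (norm (u (Suc k) - u k))\<^sup>2"
  by (simp add: theta_avg_def power2_norm_eq_inner inner_add_right inner_diff_left inner_diff_right
      inner_commute algebra_simps)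

lemma young_weighted:
  fixes x y \<epsilon> :: real
  assumes "0 < \<epsilon>"
  shows "x * y \<le> \<epsilon> * y\<^sup>2 + x\<^sup>2 / (4 * \<epsilon>)"
proof -
  have "\<epsilon> * y\<^sup>2 + x\<^sup>2 / (4 * \<epsilon>) - x * y = (x - 2 * \<epsilon> * y)\<^sup>2 / (4 * \<epsilon>)"
    using assms by (simp add: power2_eq_square field_simps)
  moreover have "0 \<le> (x - 2 * \<epsilon> * y)\<^sup>2 / (4 * \<epsilon>)"
    using assms by simp
  ultimately show ?thesis
    by linarith
qed

lemma theta_avg_mem:
  assumes "subspace W" "u k \<in> W" "u (Suc k) \<in> W"
  shows "theta_avg \<theta> u k \<in> W"
  using assms by (simp add: theta_avg_def subspace_add subspace_scale)

lemma certified_step_energy: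
  fixes u :: "nat \<Rightarrow> 'h::euclidean_space"
  assumes step: "certified_step Vh Vn A B C gradn \<nu> \<Delta>t \<theta> f u k"
    and Vn: "subspace Vn" "Vn \<subseteq> Vh"
    and dt: "0 < \<Delta>t" and \<theta>: "1 / 2 \<le> \<theta>"
    and skew: "\<forall>v\<in>Vn. orth_proj Vn (B v v) \<bullet> v = 0"
  shows "1 / 2 * (norm (u (Suc k)))\<^sup>2 - 1 / 2 * (norm (u k))\<^sup>2
      + \<nu> * \<Delta>t * (gradn (theta_avg \<theta> u k))\<^sup>2
      + \<Delta>t * (C (theta_avg \<theta> u k) \<bullet> theta_avg \<theta> u k)
    \<le> \<Delta>t * (f k \<bullet> theta_avg \<theta> u k)"
proof -
  define U where "U = theta_avg \<theta> u k"
  have U: "U \<in> Vn"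
    unfolding U_def using step Vn(1) by (intro theta_avg_mem) (auto simp: certified_step_def)
  have coercive: "A U \<bullet> U = (gradn U)\<^sup>2"
    using step U Vn(2) by (auto simp: certified_step_def)
  have skew': "B U U \<bullet> U = 0"
    using skew U orth_proj_inner[OF Vn(1) U] by metis
  have "(1 / \<Delta>t) *\<^sub>R (u (Suc k) - u k) + \<nu> *\<^sub>R orth_proj Vn (A U) + orth_proj Vn (B U U) + C U
      = orth_proj Vn (f k)"
    using step by (simp add: certified_step_def U_def)
  then have "((1 / \<Delta>t) *\<^sub>R (u (Suc k) - u k) + \<nu> *\<^sub>R orth_proj Vn (A U) + orth_proj Vn (B U U) + C U) \<bullet> U
      = orth_proj Vn (f k) \<bullet> U"
    by simp
  then have "(u (Suc k) - u k) \<bullet> U / \<Delta>t + \<nu> * (gradn U)\<^sup>2 + C U \<bullet> U = f k \<bullet> U"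
    using skew' by (simp add: inner_add_left orth_proj_inner[OF Vn(1) U] coercive)
  then have "(u (Suc k) - u k) \<bullet> U + \<nu> * \<Delta>t * (gradn U)\<^sup>2 + \<Delta>t * (C U \<bullet> U) = \<Delta>t * (f k \<bullet> U)"
    using dt by (simp add: field_simps)
  moreover have "0 \<le> (\<theta> - 1 / 2) * (norm (u (Suc k) - u k))\<^sup>2"
    using \<theta> by simp
  ultimately show ?thesis
    using theta_increment_identity[of u k \<theta>] unfolding U_def by linarith
qed

text \<open>Here \<open>E\<close> plays the role of the squared norm, so that the one-step estimate carries factors
  \<open>1/2\<close>; \<open>G\<close> and \<open>D\<close> are the squared gradient and dual norms.\<close>

lemma telescoped_energy_bound:
  fixes E G D :: "nat \<Rightarrow> real"
  assumes "\<And>j. j < k \<Longrightarrow>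
    1 / 2 * E (Suc j) - 1 / 2 * E j + c * \<tau> * G j \<le> \<tau> / (4 * \<epsilon>) * D j"
  shows "E k + 2 * c * (\<Sum>j<k. \<tau> * G j) \<le> E 0 + 1 / (2 * \<epsilon>) * (\<Sum>j<k. \<tau> * D j)"
  using assms
proof (induction k)
  case 0
  then show ?case by simp
next
  case (Suc k)
  have "E k + 2 * c * (\<Sum>j<k. \<tau> * G j) \<le> E 0 + 1 / (2 * \<epsilon>) * (\<Sum>j<k. \<tau> * D j)"
    using Suc by simp
  moreover have "E (Suc k) - E k + 2 * c * (\<tau> * G k) \<le> 1 / (2 * \<epsilon>) * (\<tau> * D k)"
    using Suc.prems[of k] by simp
  ultimately show ?case
    by (simp add: distrib_left)
qed

theorem theorem4p3:
  fixes T C_P :: real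
    and \<Omega> :: "(real^'d::finite) set"
    and bc :: "'d boundary_condition"
    and F :: "real \<Rightarrow> 'd field \<Rightarrow> real"
    and U0 :: "'d field"
    and Vh Vn :: "'h::euclidean_space set"
    and A C :: "'h \<Rightarrow> 'h"
    and B :: "'h \<Rightarrow> 'h \<Rightarrow> 'h"
    and gradn :: "'h \<Rightarrow> real"
    and C_h :: real
    and pressure :: "('h, 'q::euclidean_space) pressure_treatment"
    and n :: nat
    and \<phi> :: "nat \<Rightarrow> 'h"
    and \<nu> \<Delta>t \<theta> :: real
    and f u :: "nat \<Rightarrow> 'h"
  assumes "continuous_problem T \<Omega> bc C_P F U0"
    and "full_order_discretization Vh A B gradn C_h pressure"
    and "\<phi> ` {1..n} \<subseteq> Vh" and "inj_on \<phi> {1..n}" and "independent (\<phi> ` {1..n})"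
    and "Vn = span (\<phi> ` {1..n})"
    and "\<forall>v\<in>Vn. C v \<in> Vn"
    and "\<forall>k. f k \<in> Vh"
    and "0 < \<nu>" and "0 < \<Delta>t"
    and "\<forall>v\<in>Vn. orth_proj Vn (B v v) \<bullet> v = 0"
    and "\<forall>v\<in>Vn. 0 \<le> C v \<bullet> v"
    and "1 / 2 \<le> \<theta>" and "\<theta> \<le> 1"
  shows
    "(\<forall>k. certified_step Vh Vn A B C gradn \<nu> \<Delta>t \<theta> f u k \<longrightarrow>
        1 / 2 * (norm (u (Suc k)))\<^sup>2 - 1 / 2 * (norm (u k))\<^sup>2
          + \<nu> * \<Delta>t * (gradn (theta_avg \<theta> u k))\<^sup>2
          + \<Delta>t * (C (theta_avg \<theta> u k) \<bullet> theta_avg \<theta> u k)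
        \<le> \<Delta>t * (f k \<bullet> theta_avg \<theta> u k))
   \<and> (\<forall>k \<epsilon>. certified_step Vh Vn A B C gradn \<nu> \<Delta>t \<theta> f u k \<and> 0 < \<epsilon> \<longrightarrow>
        1 / 2 * (norm (u (Suc k)))\<^sup>2 - 1 / 2 * (norm (u k))\<^sup>2
          + (\<nu> - \<epsilon>) * \<Delta>t * (gradn (theta_avg \<theta> u k))\<^sup>2
        \<le> \<Delta>t / (4 * \<epsilon>) * (dual_norm Vh gradn (\<lambda>v. f k \<bullet> v))\<^sup>2)
   \<and> (\<forall>\<epsilon> K. 0 < \<epsilon> \<and> \<epsilon> < \<nu> \<and>
        (\<forall>j<K. certified_step Vh Vn A B C gradn \<nu> \<Delta>t \<theta> f u j) \<longrightarrow>
        (SUP k\<in>{0..K}. (norm (u k))\<^sup>2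
            + 2 * (\<nu> - \<epsilon>) * (\<Sum>j<k. \<Delta>t * (gradn (theta_avg \<theta> u j))\<^sup>2))
        \<le> (norm (u 0))\<^sup>2
            + 1 / (2 * \<epsilon>) * (\<Sum>j<K. \<Delta>t * (dual_norm Vh gradn (\<lambda>v. f j \<bullet> v))\<^sup>2))"
proof -
  interpret full_order_discretization Vh A B gradn C_h pressure
    by fact
  have Vn: "subspace Vn" "Vn \<subseteq> Vh"
    using \<open>Vn = span (\<phi> ` {1..n})\<close> \<open>\<phi> ` {1..n} \<subseteq> Vh\<close> Vh_subspace
    by (auto intro: span_minimal[THEN subsetD])
  let ?U = "theta_avg \<theta> u"
  let ?D = "\<lambda>k. dual_norm Vh gradn (\<lambda>v. f k \<bullet> v)"
  have energy: "1 / 2 * (norm (u (Suc k)))\<^sup>2 - 1 / 2 * (norm (u k))\<^sup>2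
      + \<nu> * \<Delta>t * (gradn (?U k))\<^sup>2 + \<Delta>t * (C (?U k) \<bullet> ?U k) \<le> \<Delta>t * (f k \<bullet> ?U k)"
    if "certified_step Vh Vn A B C gradn \<nu> \<Delta>t \<theta> f u k" for k
    by (rule certified_step_energy[OF that Vn])
      (fact \<open>0 < \<Delta>t\<close> \<open>1 / 2 \<le> \<theta>\<close> \<open>\<forall>v\<in>Vn. orth_proj Vn (B v v) \<bullet> v = 0\<close>)+
  have young: "1 / 2 * (norm (u (Suc k)))\<^sup>2 - 1 / 2 * (norm (u k))\<^sup>2
      + (\<nu> - \<epsilon>) * \<Delta>t * (gradn (?U k))\<^sup>2 \<le> \<Delta>t / (4 * \<epsilon>) * (?D k)\<^sup>2"
    if step: "certified_step Vh Vn A B C gradn \<nu> \<Delta>t \<theta> f u k" and \<epsilon>: "0 < \<epsilon>" for k \<epsilon>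
  proof -
    have U: "?U k \<in> Vn"
      using step Vn(1) by (intro theta_avg_mem) (auto simp: certified_step_def)
    have "f k \<bullet> ?U k \<le> ?D k * gradn (?U k)"
      using U Vn(2) by (intro inner_le_dual_norm_times[OF gradn_norm discrete_poincare]) auto
    also have "\<dots> \<le> \<epsilon> * (gradn (?U k))\<^sup>2 + (?D k)\<^sup>2 / (4 * \<epsilon>)"
      using \<epsilon> by (rule young_weighted)
    finally have "\<Delta>t * (f k \<bullet> ?U k) \<le> \<Delta>t * (\<epsilon> * (gradn (?U k))\<^sup>2 + (?D k)\<^sup>2 / (4 * \<epsilon>))"
      using \<open>0 < \<Delta>t\<close> by simp
    moreover have "0 \<le> \<Delta>t * (C (?U k) \<bullet> ?U k)"
      using \<open>\<forall>v\<in>Vn. 0 \<le> C v \<bullet> v\<close> U \<open>0 < \<Delta>t\<close> by simp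
    ultimately show ?thesis
      using energy[OF step] by (simp add: algebra_simps)
  qed
  have total: "(SUP k\<in>{0..K}. (norm (u k))\<^sup>2
        + 2 * (\<nu> - \<epsilon>) * (\<Sum>j<k. \<Delta>t * (gradn (?U j))\<^sup>2))
      \<le> (norm (u 0))\<^sup>2 + 1 / (2 * \<epsilon>) * (\<Sum>j<K. \<Delta>t * (?D j)\<^sup>2)"
    if \<epsilon>: "0 < \<epsilon>" and steps: "\<forall>j<K. certified_step Vh Vn A B C gradn \<nu> \<Delta>t \<theta> f u j" for \<epsilon> K
  proof (rule cSUP_least)
    fix k assume k: "k \<in> {0..K}"
    have "(norm (u k))\<^sup>2 + 2 * (\<nu> - \<epsilon>) * (\<Sum>j<k. \<Delta>t * (gradn (?U j))\<^sup>2)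
        \<le> (norm (u 0))\<^sup>2 + 1 / (2 * \<epsilon>) * (\<Sum>j<k. \<Delta>t * (?D j)\<^sup>2)"
      using young steps \<epsilon> k
      by (intro telescoped_energy_bound[where E = "\<lambda>j. (norm (u j))\<^sup>2"]) auto
    also have "\<dots> \<le> (norm (u 0))\<^sup>2 + 1 / (2 * \<epsilon>) * (\<Sum>j<K. \<Delta>t * (?D j)\<^sup>2)"
      using k \<epsilon> \<open>0 < \<Delta>t\<close> by (intro add_left_mono mult_left_mono sum_mono2) auto
    finally show "(norm (u k))\<^sup>2 + 2 * (\<nu> - \<epsilon>) * (\<Sum>j<k. \<Delta>t * (gradn (?U j))\<^sup>2)
        \<le> (norm (u 0))\<^sup>2 + 1 / (2 * \<epsilon>) * (\<Sum>j<K. \<Delta>t * (?D j)\<^sup>2)" .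
  qed simp
  show ?thesis
    using energy young total by blast
qed

end
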